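(* Let $\mathcal{A},\mathcal{B}$ be finite disjoint alphabets of modalities, $L_1$ a locally tabular normal modal logic over $\mathcal{A}$ and $L_2$ a locally tabular normal modal logic over $\mathcal{B}$. If the logic $L_1*L_2+\Phi(\mathcal{A},\mathcal{B})$ is Kripke complete, then it is locally tabular.
   Context: $L_1*L_2$ (the fusion) is the smallest normal modal logic over $\mathcal{A}\cup\mathcal{B}$ containing $L_1\cup L_2$; $L+\Phi$ is the smallest normal logic containing $L\cup\Phi$. $\Phi(\mathcal{A},\mathcal{B})$ is the set of all formulas $\Diamond_h\Diamond_v p\to\Diamond_v p$, $\Diamond_v\Diamond_h p\to\Diamond_v p$, $\Diamond_v p\to\Box_h\Diamond_v p$ with $\Diamond_v\in\mathcal{A}$ and $\Diamond_h\in\mathcal{B}$ ($\Box_h=\neg\Diamond_h\neg$). A logic is Kripke complete if it is the set of formulas valid in some class of Kripke frames. A logic $L$ is locally tabular if for every $k<\omega$ there are only finitely many formulas in $p_0,\ldots,p_{k-1}$ pairwise non-equivalent modulo $L$. *)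

theory Defs
  imports Main
begin

datatype (mods: 'm) fm =
    Var nat
  | Bot
  | Imp "'m fm" "'m fm"
  | Dia 'm "'m fm"

abbreviation Neg :: "'m fm \<Rightarrow> 'm fm" where
  "Neg \<phi> \<equiv> Imp \<phi> Bot"

abbreviation Or :: "'m fm \<Rightarrow> 'm fm \<Rightarrow> 'm fm" where
  "Or \<phi> \<psi> \<equiv> Imp (Neg \<phi>) \<psi>"

abbreviation And :: "'m fm \<Rightarrow> 'm fm \<Rightarrow> 'm fm" where
  "And \<phi> \<psi> \<equiv> Neg (Imp \<phi> (Neg \<psi>))"

abbreviation Iff :: "'m fm \<Rightarrow> 'm fm \<Rightarrow> 'm fm" where
  "Iff \<phi> \<psi> \<equiv> And (Imp \<phi> \<psi>) (Imp \<psi> \<phi>)"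

abbreviation Box :: "'m \<Rightarrow> 'm fm \<Rightarrow> 'm fm" where
  "Box m \<phi> \<equiv> Neg (Dia m (Neg \<phi>))"

primrec vars :: "'m fm \<Rightarrow> nat set" where
  "vars (Var n) = {n}"
| "vars Bot = {}"
| "vars (Imp \<phi> \<psi>) = vars \<phi> \<union> vars \<psi>"
| "vars (Dia m \<phi>) = vars \<phi>"

primrec subst :: "(nat \<Rightarrow> 'm fm) \<Rightarrow> 'm fm \<Rightarrow> 'm fm" where
  "subst \<sigma> (Var n) = \<sigma> n"
| "subst \<sigma> Bot = Bot"
| "subst \<sigma> (Imp \<phi> \<psi>) = Imp (subst \<sigma> \<phi>) (subst \<sigma> \<psi>)"
| "subst \<sigma> (Dia m \<phi>) = Dia m (subst \<sigma> \<phi>)"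

text \<open>An alphabet of modalities is a set \<open>A\<close> of elements of the type \<open>'m\<close>.\<close>

definition fms :: "'m set \<Rightarrow> 'm fm set" where
  "fms A = {\<phi>. mods \<phi> \<subseteq> A}"

text \<open>Boolean value of a formula whose variables and diamond subformulas
  are treated as atoms, valued by \<open>v\<close>.\<close>

primrec bool_val :: "('m fm \<Rightarrow> bool) \<Rightarrow> 'm fm \<Rightarrow> bool" where
  "bool_val v (Var n) \<longleftrightarrow> v (Var n)"
| "bool_val v Bot \<longleftrightarrow> False"
| "bool_val v (Imp \<phi> \<psi>) \<longleftrightarrow> (bool_val v \<phi> \<longrightarrow> bool_val v \<psi>)"
| "bool_val v (Dia m \<phi>) \<longleftrightarrow> v (Dia m \<phi>)"

definition tautology :: "'m fm \<Rightarrow> bool" where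
  "tautology \<phi> \<longleftrightarrow> (\<forall>v. bool_val v \<phi>)"

definition normal_logic :: "'m set \<Rightarrow> 'm fm set \<Rightarrow> bool" where
  "normal_logic A L \<longleftrightarrow>
     L \<subseteq> fms A \<and>
     (\<forall>\<phi>\<in>fms A. tautology \<phi> \<longrightarrow> \<phi> \<in> L) \<and>
     (\<forall>m\<in>A. Neg (Dia m Bot) \<in> L) \<and>
     (\<forall>m\<in>A. Imp (Dia m (Or (Var 0) (Var 1))) (Or (Dia m (Var 0)) (Dia m (Var 1))) \<in> L) \<and>
     (\<forall>\<phi> \<psi>. \<phi> \<in> L \<longrightarrow> Imp \<phi> \<psi> \<in> L \<longrightarrow> \<psi> \<in> L) \<and>
     (\<forall>\<phi>\<in>L. \<forall>\<sigma>. (\<forall>n. \<sigma> n \<in> fms A) \<longrightarrow> subst \<sigma> \<phi> \<in> L) \<and>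
     (\<forall>m\<in>A. \<forall>\<phi> \<psi>. Imp \<phi> \<psi> \<in> L \<longrightarrow> Imp (Dia m \<phi>) (Dia m \<psi>) \<in> L)"

definition least_normal_logic :: "'m set \<Rightarrow> 'm fm set \<Rightarrow> 'm fm set" where
  "least_normal_logic A S = \<Inter>{L. normal_logic A L \<and> S \<subseteq> L}"

lemma mods_subst: "mods (subst \<sigma> \<phi>) \<subseteq> mods \<phi> \<union> (\<Union>n. mods (\<sigma> n))"
  by (induction \<phi>) auto

lemma normal_logic_fms: "normal_logic A (fms A)"
proof -
  have "subst \<sigma> \<phi> \<in> fms A" if "\<phi> \<in> fms A" "\<forall>n. \<sigma> n \<in> fms A" for \<sigma> \<phi>
    using that mods_subst [of \<sigma> \<phi>] unfolding fms_def by blast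
  then show ?thesis
    unfolding normal_logic_def by (auto simp: fms_def)
qed

lemma normal_logic_Inter:
  assumes "\<L> \<noteq> {}" and "\<And>L. L \<in> \<L> \<Longrightarrow> normal_logic A L"
  shows "normal_logic A (\<Inter>\<L>)"
proof -
  have "\<Inter>\<L> \<subseteq> fms A"
    using assms unfolding normal_logic_def by blast
  then show ?thesis
    unfolding normal_logic_def using assms(2) [unfolded normal_logic_def]
    by (intro conjI ballI allI impI InterI) (simp_all, meson+)
qed

lemma normal_logic_least:
  assumes "S \<subseteq> fms A"
  shows "normal_logic A (least_normal_logic A S)"
  unfolding least_normal_logic_def
  using normal_logic_fms assms by (intro normal_logic_Inter) auto

definition fusion :: "'m set \<Rightarrow> 'm set \<Rightarrow> 'm fm set \<Rightarrow> 'm fm set \<Rightarrow> 'm fm set" where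
  "fusion A B L1 L2 = least_normal_logic (A \<union> B) (L1 \<union> L2)"

definition add_axioms :: "'m set \<Rightarrow> 'm fm set \<Rightarrow> 'm fm set \<Rightarrow> 'm fm set" where
  "add_axioms A L S = least_normal_logic A (L \<union> S)"

definition Phi :: "'m set \<Rightarrow> 'm set \<Rightarrow> 'm fm set" where
  "Phi A B =
     (\<Union>v\<in>A. \<Union>h\<in>B.
       {Imp (Dia h (Dia v (Var 0))) (Dia v (Var 0)),
        Imp (Dia v (Dia h (Var 0))) (Dia v (Var 0)),
        Imp (Dia v (Var 0)) (Box h (Dia v (Var 0)))})"

text \<open>The relations of modalities outside the alphabet in use are irrelevant.\<close>

record ('m, 'w) frame =
  worlds :: "'w set"
  rel :: "'m \<Rightarrow> ('w \<times> 'w) set"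

definition kripke_frame :: "'m set \<Rightarrow> ('m, 'w) frame \<Rightarrow> bool" where
  "kripke_frame A F \<longleftrightarrow>
     worlds F \<noteq> {} \<and> (\<forall>m\<in>A. rel F m \<subseteq> worlds F \<times> worlds F)"

primrec true_at :: "('m, 'w) frame \<Rightarrow> (nat \<Rightarrow> 'w set) \<Rightarrow> 'w \<Rightarrow> 'm fm \<Rightarrow> bool" where
  "true_at F V w (Var n) \<longleftrightarrow> w \<in> V n"
| "true_at F V w Bot \<longleftrightarrow> False"
| "true_at F V w (Imp \<phi> \<psi>) \<longleftrightarrow> (true_at F V w \<phi> \<longrightarrow> true_at F V w \<psi>)"
| "true_at F V w (Dia m \<phi>) \<longleftrightarrow> (\<exists>u. (w, u) \<in> rel F m \<and> true_at F V u \<phi>)"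

definition valid_in :: "('m, 'w) frame \<Rightarrow> 'm fm \<Rightarrow> bool" where
  "valid_in F \<phi> \<longleftrightarrow>
     (\<forall>V. (\<forall>n. V n \<subseteq> worlds F) \<longrightarrow> (\<forall>w\<in>worlds F. true_at F V w \<phi>))"

definition logic_of :: "'m set \<Rightarrow> ('m, 'w) frame set \<Rightarrow> 'm fm set" where
  "logic_of A K = {\<phi> \<in> fms A. \<forall>F\<in>K. valid_in F \<phi>}"

text \<open>HOL cannot quantify over the type of worlds inside a definition, so it is
  a parameter here.  Universally quantifying over \<open>'w\<close> in a theorem that assumes
  \<open>kripke_complete TYPE('w) A L\<close> covers frames of every cardinality.\<close>

definition kripke_complete :: "'w itself \<Rightarrow> 'm set \<Rightarrow> 'm fm set \<Rightarrow> bool" where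
  "kripke_complete _ A L \<longleftrightarrow>
     (\<exists>K :: ('m, 'w) frame set. (\<forall>F\<in>K. kripke_frame A F) \<and> L = logic_of A K)"

definition fms_in :: "'m set \<Rightarrow> nat \<Rightarrow> 'm fm set" where
  "fms_in A k = {\<phi> \<in> fms A. vars \<phi> \<subseteq> {..<k}}"

definition equiv_mod :: "'m set \<Rightarrow> 'm fm set \<Rightarrow> nat \<Rightarrow> ('m fm \<times> 'm fm) set" where
  "equiv_mod A L k = {(\<phi>, \<psi>). \<phi> \<in> fms_in A k \<and> \<psi> \<in> fms_in A k \<and> Iff \<phi> \<psi> \<in> L}"

definition locally_tabular :: "'m set \<Rightarrow> 'm fm set \<Rightarrow> bool" where
  "locally_tabular A L \<longleftrightarrow> (\<forall>k. finite (fms_in A k // equiv_mod A L k))"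

end

(* Modulo Phi, a diamond h from B commutes with conjunction by formulas Dia v phi and
   Neg (Dia v phi), v from A, so such formulas can be pulled out of its scope.  Hence every
   formula in k variables is equivalent to an A-formula applied to B-formulas in k variables.
   Up to L2 there are only finitely many of the latter, say N, and up to L1 only finitely
   many A-formulas in N variables. *)
theory Submission imports Defs begin

section \<open>Formulas, substitution and normal logics\<close>

lemma fms_in_simps [simp]:
  "Var n \<in> fms_in A k \<longleftrightarrow> n < k"
  "Bot \<in> fms_in A k"
  "Imp \<phi> \<psi> \<in> fms_in A k \<longleftrightarrow> \<phi> \<in> fms_in A k \<and> \<psi> \<in> fms_in A k"
  "Dia m \<phi> \<in> fms_in A k \<longleftrightarrow> m \<in> A \<and> \<phi> \<in> fms_in A k"
  by (auto simp: fms_in_def fms_def)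

lemma fms_in_fms: "\<phi> \<in> fms_in A k \<Longrightarrow> \<phi> \<in> fms A"
  by (simp add: fms_in_def)

lemma fms_in_mono: "\<phi> \<in> fms_in A k \<Longrightarrow> A \<subseteq> A' \<Longrightarrow> \<phi> \<in> fms_in A' k"
  by (auto simp: fms_in_def fms_def)

lemma fms_subst: "\<phi> \<in> fms A \<Longrightarrow> (\<And>n. \<sigma> n \<in> fms A) \<Longrightarrow> subst \<sigma> \<phi> \<in> fms A"
  by (induction \<phi>) (auto simp: fms_def)

lemma fms_in_subst:
  "\<phi> \<in> fms_in A n \<Longrightarrow> (\<And>i. i < n \<Longrightarrow> \<sigma> i \<in> fms_in A k) \<Longrightarrow> subst \<sigma> \<phi> \<in> fms_in A k"
  by (induction \<phi>) auto

lemma normal_logic_subset_fms: "normal_logic A L \<Longrightarrow> L \<subseteq> fms A"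
  by (simp add: normal_logic_def)

lemma normal_logic_taut: "normal_logic A L \<Longrightarrow> \<phi> \<in> fms A \<Longrightarrow> tautology \<phi> \<Longrightarrow> \<phi> \<in> L"
  by (simp add: normal_logic_def)

lemma normal_logic_mp: "normal_logic A L \<Longrightarrow> Imp \<phi> \<psi> \<in> L \<Longrightarrow> \<phi> \<in> L \<Longrightarrow> \<psi> \<in> L"
  unfolding normal_logic_def by blast

lemma normal_logic_subst:
  "normal_logic A L \<Longrightarrow> \<phi> \<in> L \<Longrightarrow> (\<And>n. \<sigma> n \<in> fms A) \<Longrightarrow> subst \<sigma> \<phi> \<in> L"
  unfolding normal_logic_def by blast

lemma least_normal_logic_superset: "S \<subseteq> least_normal_logic A S"
  by (auto simp: least_normal_logic_def)

section \<open>Local tabularity through finite sets of representatives\<close>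

lemma equiv_equiv_mod:
  assumes L: "normal_logic A L"
  shows "equiv (fms_in A k) (equiv_mod A L k)"
proof (rule equivI)
  show "equiv_mod A L k \<subseteq> fms_in A k \<times> fms_in A k"
    by (auto simp: equiv_mod_def)
  show "refl_on (fms_in A k) (equiv_mod A L k)"
  proof (rule refl_onI)
    fix \<phi> assume "\<phi> \<in> fms_in A k"
    then show "(\<phi>, \<phi>) \<in> equiv_mod A L k"
      using normal_logic_taut[OF L, of "Iff \<phi> \<phi>"]
      by (auto simp: equiv_mod_def tautology_def fms_in_def fms_def)
  qed
  show "sym (equiv_mod A L k)"
  proof (rule symI)
    fix \<phi> \<psi> assume "(\<phi>, \<psi>) \<in> equiv_mod A L k"
    then show "(\<psi>, \<phi>) \<in> equiv_mod A L k"
      using normal_logic_mp[OF L normal_logic_taut[OF L, of "Imp (Iff \<phi> \<psi>) (Iff \<psi> \<phi>)"]]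
      by (auto simp: equiv_mod_def tautology_def fms_in_def fms_def)
  qed
  show "trans (equiv_mod A L k)"
  proof (rule transI)
    fix \<phi> \<psi> \<chi> assume *: "(\<phi>, \<psi>) \<in> equiv_mod A L k" "(\<psi>, \<chi>) \<in> equiv_mod A L k"
    have "tautology (Imp (Iff \<phi> \<psi>) (Imp (Iff \<psi> \<chi>) (Iff \<phi> \<chi>)))"
      unfolding tautology_def bool_val.simps by blast
    moreover have "Imp (Iff \<phi> \<psi>) (Imp (Iff \<psi> \<chi>) (Iff \<phi> \<chi>)) \<in> fms A"
      using * by (simp add: equiv_mod_def fms_in_def fms_def)
    ultimately have "Imp (Iff \<phi> \<psi>) (Imp (Iff \<psi> \<chi>) (Iff \<phi> \<chi>)) \<in> L"
      by (intro normal_logic_taut[OF L])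
    moreover have "Iff \<phi> \<psi> \<in> L" "Iff \<psi> \<chi> \<in> L"
      using * by (simp_all add: equiv_mod_def)
    ultimately have "Iff \<phi> \<chi> \<in> L"
      using normal_logic_mp[OF L] by metis
    then show "(\<phi>, \<chi>) \<in> equiv_mod A L k"
      using * by (simp add: equiv_mod_def)
  qed
qed

text \<open>Picking one formula from each class turns finitely many classes into a finite
  \<open>R\<close>, and conversely the classes of the members of \<open>R\<close> are all the
  classes. The proof works with this form throughout: it yields representatives for
  \<open>L1\<close> and \<open>L2\<close>, and the conclusion is reached by exhibiting some for the
  combined logic.\<close>

lemma locally_tabular_iff:
  assumes L: "normal_logic A L"
  shows "locally_tabular A L \<longleftrightarrow>
    (\<forall>k. \<exists>R. finite R \<and> R \<subseteq> fms_in A k \<and> (\<forall>\<phi>\<in>fms_in A k. \<exists>\<rho>\<in>R. Iff \<phi> \<rho> \<in> L))"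
    (is "_ \<longleftrightarrow> (\<forall>k. ?fin k)")
proof -
  have "finite (fms_in A k // equiv_mod A L k) \<longleftrightarrow> ?fin k" for k
  proof -
    let ?X = "fms_in A k" and ?r = "equiv_mod A L k"
    note eq = equiv_equiv_mod[OF L, of k]
    show ?thesis
    proof
      assume fin: "finite (?X // ?r)"
      have "?X // ?r \<subseteq> (\<lambda>\<phi>. ?r `` {\<phi>}) ` ?X"
        by (auto simp: quotient_def)
      from finite_subset_image[OF fin this]
      obtain R where R: "R \<subseteq> ?X" "finite R" "?X // ?r = (\<lambda>\<phi>. ?r `` {\<phi>}) ` R"
        by blast
      have "\<forall>\<phi>\<in>?X. \<exists>\<rho>\<in>R. Iff \<phi> \<rho> \<in> L"
      proof
        fix \<phi> assume \<phi>: "\<phi> \<in> ?X"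
        from quotientI[OF \<phi>, of ?r] R(3)
        obtain \<rho> where "\<rho> \<in> R" "?r `` {\<phi>} = ?r `` {\<rho>}" by auto
        then have "(\<phi>, \<rho>) \<in> ?r"
          using eq_equiv_class[OF _ eq] R(1) by blast
        with \<open>\<rho> \<in> R\<close> show "\<exists>\<rho>\<in>R. Iff \<phi> \<rho> \<in> L" by (auto simp: equiv_mod_def)
      qed
      with R(1,2) show "?fin k" by (intro exI conjI)
    next
      assume "?fin k"
      then obtain R where R: "finite R" "R \<subseteq> ?X" "\<forall>\<phi>\<in>?X. \<exists>\<rho>\<in>R. Iff \<phi> \<rho> \<in> L"
        by (elim exE conjE)
      have "?X // ?r \<subseteq> (\<lambda>\<phi>. ?r `` {\<phi>}) ` R"
      proof
        fix c assume "c \<in> ?X // ?r"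
        then obtain \<phi> where \<phi>: "\<phi> \<in> ?X" "c = ?r `` {\<phi>}" by (auto simp: quotient_def)
        with R obtain \<rho> where "\<rho> \<in> R" "Iff \<phi> \<rho> \<in> L" by blast
        then have "(\<phi>, \<rho>) \<in> ?r" using \<phi> R by (auto simp: equiv_mod_def)
        then show "c \<in> (\<lambda>\<phi>. ?r `` {\<phi>}) ` R"
          using \<phi> \<open>\<rho> \<in> R\<close> equiv_class_eq[OF eq] by blast
      qed
      then show "finite (?X // ?r)" using R(1) by (meson finite_imageI finite_subset)
    qed
  qed
  then show ?thesis by (simp add: locally_tabular_def)
qed

section \<open>Equivalence over a class of frames\<close>

definition sem_equiv :: "('m, 'w) frame set \<Rightarrow> 'm fm \<Rightarrow> 'm fm \<Rightarrow> bool" where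
  "sem_equiv K \<phi> \<psi> \<longleftrightarrow> (\<forall>F\<in>K. \<forall>V. (\<forall>n. V n \<subseteq> worlds F) \<longrightarrow>
     (\<forall>w\<in>worlds F. true_at F V w \<phi> \<longleftrightarrow> true_at F V w \<psi>))"

lemma sem_equiv_trans: "sem_equiv K \<phi> \<psi> \<Longrightarrow> sem_equiv K \<psi> \<chi> \<Longrightarrow> sem_equiv K \<phi> \<chi>"
  by (simp add: sem_equiv_def)

text \<open>This is the bridge between derivability and truth for a Kripke complete logic. Left to
  right is soundness; right to left is completeness, which brings a semantic normal form back into
  the logic.\<close>

lemma Iff_in_logic_of:
  assumes "\<phi> \<in> fms A" "\<psi> \<in> fms A"
  shows "Iff \<phi> \<psi> \<in> logic_of A K \<longleftrightarrow> sem_equiv K \<phi> \<psi>"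
  using assms by (auto simp: logic_of_def sem_equiv_def valid_in_def fms_def)

text \<open>Since \<open>sem_equiv\<close> compares formulas at \<open>worlds F\<close> only,
  successors must not leave that set; \<open>kripke_frame\<close> guarantees this for the modalities
  of \<open>A\<close>.\<close>

lemma sem_equiv_Dia:
  assumes "\<forall>F\<in>K. kripke_frame A F" "m \<in> A" "sem_equiv K \<phi> \<psi>"
  shows "sem_equiv K (Dia m \<phi>) (Dia m \<psi>)"
  using assms unfolding sem_equiv_def kripke_frame_def true_at.simps by blast

section \<open>Normal forms: pulling \<open>A\<close>-diamonds out of the scope of
  \<open>B\<close>-diamonds\<close>

primrec outer_dias :: "'m fm \<Rightarrow> 'm fm set" where
  "outer_dias (Var n) = {}"
| "outer_dias Bot = {}"
| "outer_dias (Imp \<phi> \<psi>) = outer_dias \<phi> \<union> outer_dias \<psi>"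
| "outer_dias (Dia m \<phi>) = {Dia m \<phi>}"

text \<open>With \<gamma> one of the two truth constants this gives the two cofactors of a Shannon
  expansion. Nothing below a diamond is touched, because there \<delta> would be evaluated at
  another world, where its value may differ.\<close>

primrec replace_dia :: "'m fm \<Rightarrow> 'm fm \<Rightarrow> 'm fm \<Rightarrow> 'm fm" where
  "replace_dia \<delta> \<gamma> (Var n) = Var n"
| "replace_dia \<delta> \<gamma> Bot = Bot"
| "replace_dia \<delta> \<gamma> (Imp \<phi> \<psi>) = Imp (replace_dia \<delta> \<gamma> \<phi>) (replace_dia \<delta> \<gamma> \<psi>)"
| "replace_dia \<delta> \<gamma> (Dia m \<phi>) = (if Dia m \<phi> = \<delta> then \<gamma> else Dia m \<phi>)"

lemma finite_outer_dias: "finite (outer_dias \<phi>)"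
  by (induction \<phi>) auto

lemma outer_dias_replace_dia:
  "outer_dias \<gamma> = {} \<Longrightarrow> outer_dias (replace_dia \<delta> \<gamma> \<phi>) = outer_dias \<phi> - {\<delta>}"
  by (induction \<phi>) auto

lemma replace_dia_fms_in:
  "\<phi> \<in> fms_in A k \<Longrightarrow> \<gamma> \<in> fms_in A k \<Longrightarrow> replace_dia \<delta> \<gamma> \<phi> \<in> fms_in A k"
  by (induction \<phi>) auto

lemma outer_dias_fms_in: "\<phi> \<in> fms_in A k \<Longrightarrow> \<delta> \<in> outer_dias \<phi> \<Longrightarrow> \<delta> \<in> fms_in A k"
  by (induction \<phi>) auto

lemma outer_dias_Dia: "\<delta> \<in> outer_dias \<phi> \<Longrightarrow> \<exists>m \<chi>. \<delta> = Dia m \<chi>"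
  by (induction \<phi>) auto

lemma true_at_replace_dia:
  "true_at F V w (subst \<sigma> \<gamma>) \<longleftrightarrow> true_at F V w (subst \<sigma> \<delta>) \<Longrightarrow>
   true_at F V w (subst \<sigma> (replace_dia \<delta> \<gamma> \<phi>)) \<longleftrightarrow> true_at F V w (subst \<sigma> \<phi>)"
  by (induction \<phi>) auto

text \<open>Without outer diamonds there are no diamonds at all, so every modality of the result
  comes from \<sigma>. This allows the passage from \<open>A\<close> to \<open>B\<close>.\<close>

lemma subst_fms_in_no_dias:
  "\<phi> \<in> fms_in A n \<Longrightarrow> outer_dias \<phi> = {} \<Longrightarrow> (\<And>i. i < n \<Longrightarrow> \<sigma> i \<in> fms_in B k) \<Longrightarrow>
   subst \<sigma> \<phi> \<in> fms_in B k"
  by (induction \<phi>) auto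

text \<open>Read at \<open>w\<close>, the axiom \<open>Imp (Dia h (Dia v p)) (Dia v p)\<close>
  carries truth from \<open>u\<close> back to \<open>w\<close>, and
  \<open>Imp (Dia v p) (Box h (Dia v p))\<close> carries it from \<open>w\<close> to
  \<open>u\<close>.\<close>

lemma true_at_Dia_invariant:
  assumes L: "normal_logic (A \<union> B) L" "Phi A B \<subseteq> L" "L = logic_of (A \<union> B) K"
    and K: "F \<in> K" "kripke_frame (A \<union> B) F" "\<forall>n. V n \<subseteq> worlds F"
    and vh: "v \<in> A" "h \<in> B" "\<chi> \<in> fms (A \<union> B)"
    and wu: "(w, u) \<in> rel F h"
  shows "true_at F V u (Dia v \<chi>) \<longleftrightarrow> true_at F V w (Dia v \<chi>)"
proof -
  have w: "w \<in> worlds F"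
    using K(2) vh wu unfolding kripke_frame_def by blast
  \<comment> \<open>The axioms in \<open>Phi\<close> have \<open>Var 0\<close> as their only
    variable, so a constant substitution instantiates them.\<close>
  have inst: "true_at F V w (subst (\<lambda>_. \<chi>) \<phi>)" if "\<phi> \<in> Phi A B" for \<phi>
  proof -
    have "\<phi> \<in> L"
      using that L(2) by (rule subsetD[rotated])
    then have "subst (\<lambda>_. \<chi>) \<phi> \<in> L"
      by (rule normal_logic_subst[OF L(1)]) (rule vh(3))
    then have "valid_in F (subst (\<lambda>_. \<chi>) \<phi>)"
      using K(1) unfolding L(3) logic_of_def by simp
    then show ?thesis
      using K(3) w by (simp add: valid_in_def)
  qed
  have "Imp (Dia h (Dia v (Var 0))) (Dia v (Var 0)) \<in> Phi A B"
    and "Imp (Dia v (Var 0)) (Box h (Dia v (Var 0))) \<in> Phi A B"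
    using vh by (auto simp: Phi_def)
  from inst[OF this(1)] inst[OF this(2)] wu show ?thesis
    unfolding subst.simps true_at.simps by blast
qed

text \<open>The sequence \<beta> lists the \<open>B\<close>-formulas in \<open>k\<close> variables
  up to equivalence, with indices below \<open>N\<close> sufficing. The induction removes one outer
  diamond of \<alpha> at a time; by \<open>true_at_Dia_invariant\<close> its value is the same at a
  world and at all \<open>h\<close>-successors of that world.\<close>

lemma Dia_pull_out:
  fixes \<beta> :: "nat \<Rightarrow> 'm fm" and K :: "('m, 'w) frame set"
  assumes L: "normal_logic (A \<union> B) L" "Phi A B \<subseteq> L" "L = logic_of (A \<union> B) K"
    and K: "\<forall>F\<in>K. kripke_frame (A \<union> B) F"
    and \<beta>: "\<And>n. \<beta> n \<in> fms_in B k"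
      "\<And>\<psi>. \<psi> \<in> fms_in B k \<Longrightarrow> \<exists>i<N. sem_equiv K \<psi> (\<beta> i)"
    and h: "h \<in> B" and \<alpha>: "\<alpha> \<in> fms_in A N"
  shows "\<exists>\<alpha>'\<in>fms_in A N. sem_equiv K (Dia h (subst \<beta> \<alpha>)) (subst \<beta> \<alpha>')"
  using finite_outer_dias[of \<alpha>] \<alpha>
proof (induction "outer_dias \<alpha>" arbitrary: \<alpha> rule: finite_induct)
  case empty
  \<comment> \<open>Here \<alpha> is a Boolean combination of variables, so its instance is a
    \<open>B\<close>-formula. Prefixing \<open>Dia h\<close> keeps it one, and some \<beta>
    \<open>i\<close> is equivalent to it.\<close>
  then have "Dia h (subst \<beta> \<alpha>) \<in> fms_in B k"
    using subst_fms_in_no_dias[of \<alpha> A N \<beta> B k] \<beta>(1) h by simp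
  then obtain i where "i < N" "sem_equiv K (Dia h (subst \<beta> \<alpha>)) (\<beta> i)"
    using \<beta>(2) by blast
  then show ?case by (intro bexI[of _ "Var i"]) auto
next
  case (insert \<delta> D)
  have \<delta>: "\<delta> \<in> fms_in A N"
    using insert outer_dias_fms_in by blast
  obtain v \<chi> where v\<chi>: "\<delta> = Dia v \<chi>"
    using insert outer_dias_Dia by blast
  \<comment> \<open>The formula \<chi> is over \<open>A\<close>, but substituting \<beta> brings in
    modalities of \<open>B\<close>; hence invariance is needed for arguments over the union.\<close>
  have \<chi>: "v \<in> A" "subst \<beta> \<chi> \<in> fms (A \<union> B)"
    using \<delta> v\<chi> \<beta>(1) by (auto intro!: fms_subst intro: fms_in_fms[OF fms_in_mono])
  let ?\<alpha> = "\<lambda>\<gamma>. replace_dia \<delta> \<gamma> \<alpha>"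
  \<comment> \<open>Both truth constants are free of diamonds, so the induction hypothesis for
    \<open>D\<close> applies to both cofactors.\<close>
  have D: "D = outer_dias (?\<alpha> \<gamma>)" if "outer_dias \<gamma> = {}" for \<gamma>
    using outer_dias_replace_dia[OF that, of \<delta> \<alpha>] insert by auto
  obtain \<alpha>1 where \<alpha>1: "\<alpha>1 \<in> fms_in A N"
    "sem_equiv K (Dia h (subst \<beta> (?\<alpha> (Neg Bot)))) (subst \<beta> \<alpha>1)"
    using insert.hyps(3)[OF D[of "Neg Bot"]] insert.prems by (auto simp: replace_dia_fms_in)
  obtain \<alpha>0 where \<alpha>0: "\<alpha>0 \<in> fms_in A N"
    "sem_equiv K (Dia h (subst \<beta> (?\<alpha> Bot))) (subst \<beta> \<alpha>0)"
    using insert.hyps(3)[OF D[of Bot]] insert.prems by (auto simp: replace_dia_fms_in)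
  \<comment> \<open>Shannon expansion of \<open>\<alpha>\<close> at the atom \<open>\<delta>\<close>, whose value does not change along \<open>h\<close>.\<close>
  let ?\<alpha>' = "And (Imp \<delta> \<alpha>1) (Imp (Neg \<delta>) \<alpha>0)"
  have "sem_equiv K (Dia h (subst \<beta> \<alpha>)) (subst \<beta> ?\<alpha>')"
    unfolding sem_equiv_def
  proof (intro ballI allI impI)
    fix F :: "('m, 'w) frame" and V :: "nat \<Rightarrow> 'w set" and w
    assume F: "F \<in> K" and V: "\<forall>n. V n \<subseteq> worlds F" and w: "w \<in> worlds F"
    let ?t = "\<lambda>u \<phi>. true_at F V u (subst \<beta> \<phi>)"
    have inv: "?t u \<delta> \<longleftrightarrow> ?t w \<delta>" if "(w, u) \<in> rel F h" for u
      using true_at_Dia_invariant[OF L F _ V \<chi>(1) h \<chi>(2) that] K F v\<chi> by simp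
    have eq1: "?t w \<alpha>1 \<longleftrightarrow> (\<exists>u. (w, u) \<in> rel F h \<and> ?t u (?\<alpha> (Neg Bot)))"
      and eq0: "?t w \<alpha>0 \<longleftrightarrow> (\<exists>u. (w, u) \<in> rel F h \<and> ?t u (?\<alpha> Bot))"
      using \<alpha>1(2) \<alpha>0(2) F V w unfolding sem_equiv_def by simp_all
    show "true_at F V w (Dia h (subst \<beta> \<alpha>)) \<longleftrightarrow> ?t w ?\<alpha>'"
    proof (cases "?t w \<delta>")
      case True
      then have "?t u (?\<alpha> (Neg Bot)) \<longleftrightarrow> ?t u \<alpha>" if "(w, u) \<in> rel F h" for u
        using inv[OF that] by (intro true_at_replace_dia) simp
      with True eq1 show ?thesis by auto
    next
      case False
      then have "?t u (?\<alpha> Bot) \<longleftrightarrow> ?t u \<alpha>" if "(w, u) \<in> rel F h" for u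
        using inv[OF that] by (intro true_at_replace_dia) simp
      with False eq0 show ?thesis by auto
    qed
  qed
  moreover have "?\<alpha>' \<in> fms_in A N"
    using \<delta> \<alpha>1(1) \<alpha>0(1) by simp
  ultimately show ?case by blast
qed

text \<open>Implications and diamonds from \<open>A\<close> commute with substitution, and a
  variable below \<open>k\<close> is itself a \<open>B\<close>-formula, hence equivalent to some
  \<beta> \<open>i\<close>. Only a diamond from \<open>B\<close> needs
  \<open>Dia_pull_out\<close>.\<close>

lemma normal_form:
  fixes \<beta> :: "nat \<Rightarrow> 'm fm"
  assumes L: "normal_logic (A \<union> B) L" "Phi A B \<subseteq> L" "L = logic_of (A \<union> B) K"
    and K: "\<forall>F\<in>K. kripke_frame (A \<union> B) F"
    and \<beta>: "\<And>n. \<beta> n \<in> fms_in B k"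
      "\<And>\<psi>. \<psi> \<in> fms_in B k \<Longrightarrow> \<exists>i<N. sem_equiv K \<psi> (\<beta> i)"
    and \<phi>: "\<phi> \<in> fms_in (A \<union> B) k"
  shows "\<exists>\<alpha>\<in>fms_in A N. sem_equiv K \<phi> (subst \<beta> \<alpha>)"
  using \<phi>
proof (induction \<phi>)
  case (Var n)
  with \<beta>(2)[of "Var n"] obtain i where "i < N" "sem_equiv K (Var n) (\<beta> i)" by auto
  then show ?case by (intro bexI[of _ "Var i"]) auto
next
  case Bot
  show ?case by (intro bexI[of _ Bot]) (auto simp: sem_equiv_def)
next
  case (Imp \<phi> \<psi>)
  then obtain \<alpha> \<alpha>' where "\<alpha> \<in> fms_in A N" "sem_equiv K \<phi> (subst \<beta> \<alpha>)"
    "\<alpha>' \<in> fms_in A N" "sem_equiv K \<psi> (subst \<beta> \<alpha>')" by auto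
  then show ?case by (intro bexI[of _ "Imp \<alpha> \<alpha>'"]) (auto simp: sem_equiv_def)
next
  case (Dia m \<phi>)
  then obtain \<alpha> where \<alpha>: "\<alpha> \<in> fms_in A N" "sem_equiv K \<phi> (subst \<beta> \<alpha>)" by auto
  have m: "m \<in> A \<union> B" using Dia.prems by simp
  have eq: "sem_equiv K (Dia m \<phi>) (Dia m (subst \<beta> \<alpha>))"
    by (rule sem_equiv_Dia[OF K m \<alpha>(2)])
  show ?case
  proof (cases "m \<in> A")
    case True
    with eq \<alpha>(1) show ?thesis by (intro bexI[of _ "Dia m \<alpha>"]) auto
  next
    case False
    with m have "m \<in> B" by simp
    from Dia_pull_out[OF L K \<beta> this \<alpha>(1)] eq show ?thesis
      using sem_equiv_trans by blast
  qed
qed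

section \<open>Combining the representatives of both logics\<close>

theorem theorem5p10:
  fixes A B :: "'m set" and L1 L2 :: "'m fm set"
  assumes "finite A" and "finite B" and "A \<inter> B = {}"
    and "normal_logic A L1" and "locally_tabular A L1"
    and "normal_logic B L2" and "locally_tabular B L2"
    and "kripke_complete TYPE('w) (A \<union> B) (add_axioms (A \<union> B) (fusion A B L1 L2) (Phi A B))"
  shows "locally_tabular (A \<union> B) (add_axioms (A \<union> B) (fusion A B L1 L2) (Phi A B))"
proof -
  define L where "L = add_axioms (A \<union> B) (fusion A B L1 L2) (Phi A B)"
  have L12: "L1 \<union> L2 \<subseteq> fms (A \<union> B)"
    using normal_logic_subset_fms[OF assms(4)] normal_logic_subset_fms[OF assms(6)]
    by (auto simp: fms_def)
  have "Phi A B \<subseteq> fms (A \<union> B)"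
    by (auto simp: Phi_def fms_def)
  moreover have "fusion A B L1 L2 \<subseteq> fms (A \<union> B)"
    unfolding fusion_def by (rule normal_logic_subset_fms[OF normal_logic_least[OF L12]])
  ultimately have nL: "normal_logic (A \<union> B) L"
    unfolding L_def add_axioms_def by (intro normal_logic_least) simp
  have sub: "L1 \<subseteq> L" "L2 \<subseteq> L" "Phi A B \<subseteq> L"
    using least_normal_logic_superset[of "L1 \<union> L2" "A \<union> B"]
      least_normal_logic_superset[of "fusion A B L1 L2 \<union> Phi A B" "A \<union> B"]
    unfolding L_def add_axioms_def fusion_def by blast+
  obtain K :: "('m, 'w) frame set"
    where K: "\<forall>F\<in>K. kripke_frame (A \<union> B) F" "L = logic_of (A \<union> B) K"
    using assms(8) unfolding kripke_complete_def L_def by blast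
  have "\<exists>R. finite R \<and> R \<subseteq> fms_in (A \<union> B) k \<and> (\<forall>\<phi>\<in>fms_in (A \<union> B) k. \<exists>\<rho>\<in>R. Iff \<phi> \<rho> \<in> L)" for k
  proof -
    obtain R where R: "finite R" "R \<subseteq> fms_in B k" "\<forall>\<psi>\<in>fms_in B k. \<exists>\<rho>\<in>R. Iff \<psi> \<rho> \<in> L2"
      using iffD1[OF locally_tabular_iff[OF assms(6)] assms(7), THEN spec, of k]
      by (elim exE conjE)
    obtain xs where xs: "set xs = R" using finite_list[OF R(1)] by blast
    \<comment> \<open>A substitution is a total function. The default \<open>Bot\<close> keeps every
      \<beta> \<open>n\<close> in \<open>fms_in B k\<close>, so that closure of \<open>L\<close>
      under substitution applies to \<beta>.\<close>
    define \<beta> where "\<beta> n = (if n < length xs then xs ! n else Bot)" for n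
    have \<beta>: "\<beta> n \<in> fms_in B k" for n
      using R(2) xs by (auto simp: \<beta>_def)
    have \<beta>_fms: "\<beta> n \<in> fms_in (A \<union> B) k" for n
      by (rule fms_in_mono[OF \<beta>]) simp
    have rep: "\<exists>i<length xs. sem_equiv K \<psi> (\<beta> i)" if \<psi>: "\<psi> \<in> fms_in B k" for \<psi>
    proof -
      obtain \<rho> where \<rho>: "\<rho> \<in> R" "Iff \<psi> \<rho> \<in> L" using R(3) \<psi> sub by blast
      obtain i where i: "i < length xs" "\<rho> = \<beta> i"
        using \<rho>(1) xs by (auto simp: \<beta>_def in_set_conv_nth)
      have "\<psi> \<in> fms (A \<union> B)" using \<psi> by (auto intro: fms_in_fms[OF fms_in_mono])
      then show ?thesis
        using \<rho>(2) i Iff_in_logic_of[of \<psi> "A \<union> B" \<rho> K] K(2) fms_in_fms[OF \<beta>_fms] by blast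
    qed
    obtain S where S: "finite S" "S \<subseteq> fms_in A (length xs)"
      "\<forall>\<alpha>\<in>fms_in A (length xs). \<exists>\<rho>\<in>S. Iff \<alpha> \<rho> \<in> L1"
      using iffD1[OF locally_tabular_iff[OF assms(4)] assms(5), THEN spec, of "length xs"]
      by (elim exE conjE)
    have subst_in: "subst \<beta> \<alpha> \<in> fms_in (A \<union> B) k" if "\<alpha> \<in> fms_in A (length xs)" for \<alpha>
      by (rule fms_in_subst[OF fms_in_mono[OF that]]) (auto simp: \<beta>_fms)
    \<comment> \<open>The finite set of representatives is the image of \<open>S\<close>: take a
      normal form \<open>subst \<beta> \<alpha>\<close> of \<phi>, then replace \<alpha> by its
      representative modulo \<open>L1\<close>.\<close>
    have "\<exists>\<rho>\<in>subst \<beta> ` S. Iff \<phi> \<rho> \<in> L" if \<phi>: "\<phi> \<in> fms_in (A \<union> B) k" for \<phi>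
    proof -
      have "\<exists>\<alpha>\<in>fms_in A (length xs). sem_equiv K \<phi> (subst \<beta> \<alpha>)"
        by (rule normal_form[OF nL sub(3) K(2,1) \<beta> _ \<phi>]) (rule rep)
      then obtain \<alpha> where \<alpha>: "\<alpha> \<in> fms_in A (length xs)" "sem_equiv K \<phi> (subst \<beta> \<alpha>)"
        by (elim bexE)
      \<comment> \<open>The equivalence is moved from \<open>L1\<close> to \<open>L\<close> before
        substituting: the formulas \<beta> \<open>n\<close> are over \<open>B\<close>, while
        \<open>L1\<close> is closed only under substitutions of \<open>A\<close>-formulas.\<close>
      obtain \<rho> where \<rho>: "\<rho> \<in> S" "Iff \<alpha> \<rho> \<in> L" using S(3) \<alpha>(1) sub by blast
      have "Iff (subst \<beta> \<alpha>) (subst \<beta> \<rho>) \<in> L"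
        using normal_logic_subst[OF nL \<rho>(2), of \<beta>] fms_in_fms[OF \<beta>_fms] by simp
      then have "sem_equiv K (subst \<beta> \<alpha>) (subst \<beta> \<rho>)"
        using Iff_in_logic_of K(2) fms_in_fms subst_in \<alpha>(1) \<rho>(1) S(2) by blast
      with \<alpha>(2) have "sem_equiv K \<phi> (subst \<beta> \<rho>)" by (rule sem_equiv_trans)
      \<comment> \<open>Here Kripke completeness is decisive: equivalence in all frames of
        \<open>K\<close> yields membership in \<open>L\<close>.\<close>
      then have "Iff \<phi> (subst \<beta> \<rho>) \<in> L"
        using Iff_in_logic_of K(2) fms_in_fms subst_in \<phi> \<rho>(1) S(2) by blast
      with \<rho>(1) show ?thesis by blast
    qed
    moreover have "subst \<beta> ` S \<subseteq> fms_in (A \<union> B) k" using S(2) subst_in by blast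
    ultimately show ?thesis using S(1) by blast
  qed
  then show ?thesis
    using locally_tabular_iff[OF nL] unfolding L_def by blast
qed

end
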